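(* Let $\alpha=(\mathcal{F}_{i+1})_{i\geqslant 0}=(1,1,2,3,5,8,\ldots)$ and $\tilde{\alpha}=((-1)^i\mathcal{F}_{i+1})_{i\geqslant 0}$, so that the binomial transforms are $\check{\alpha}=(\mathcal{F}_{2i+1})_{i\geqslant 0}=(1,2,5,13,34,\ldots)$ and $\check{\tilde{\alpha}}=(\mathcal{F}_{i-1})_{i\geqslant 0}=(1,0,1,1,2,3,5,\ldots)$. Then the infinite integer matrices $T_{\tilde{\alpha},\alpha}$, $T_{\alpha,\tilde{\alpha}}$, $P_{\check{\tilde{\alpha}},\check{\alpha}}$, $P_{\check{\alpha},\check{\tilde{\alpha}}}$, $A_{\check{\tilde{\alpha}},\alpha}$ and $A_{\check{\alpha},\tilde{\alpha}}$ are equimodular. More precisely, for all integers $n\geqslant 0$, $$\det T_{\tilde{\alpha},\alpha}(n)=\det T_{\alpha,\tilde{\alpha}}(n)=\det P_{\check{\tilde{\alpha}},\check{\alpha}}(n)=\det P_{\check{\alpha},\check{\tilde{\alpha}}}(n)=\det A_{\check{\tilde{\alpha}},\alpha}(n)=\det A_{\check{\alpha},\tilde{\alpha}}(n)=\mathcal{F}_{n+2}.$$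
   Context: $\mathcal{F}_n$ is the $n$th Fibonacci number: $\mathcal{F}_0=0$, $\mathcal{F}_1=1$, $\mathcal{F}_n=\mathcal{F}_{n-1}+\mathcal{F}_{n-2}$ for $n\geqslant 2$, with $\mathcal{F}_{-1}=1$. For a sequence $\omega=(\omega_i)_{i\geqslant 0}$, $\check{\omega}=(\check{\omega}_i)_{i\geqslant 0}$ is defined by $\check{\omega}_i=\sum_{k=0}^{i}\binom{i}{k}\omega_k$. Let $\alpha,\beta$ be sequences with $\alpha_0=\beta_0$. The following are square matrices of order $n+1$, indexed from $(0,0)$, each with first column given by $\alpha$ and first row given by $\beta$ (i.e. $(i,0)$-entry $\alpha_i$ and $(0,i)$-entry $\beta_i$ for $0\leqslant i\leqslant n$): $T_{\alpha,\beta}(n)=[T_{i,j}]$ is the Toeplitz matrix, with $T_{i,j}=T_{k,l}$ whenever $i-j=k-l$; $P_{\alpha,\beta}(n)=[P_{i,j}]$ is the generalized Pascal triangle, with $P_{i,j}=P_{i,j-1}+P_{i-1,j}$ for $1\leqslant i,j\leqslant n$; $A_{\alpha,\beta}(n)=[A_{i,j}]$ is the 7-matrix, with $A_{i,j}=A_{i-1,j-1}+A_{i-1,j}$ for $1\leqslant i,j\leqslant n$. $T_{\alpha,\beta}$, $P_{\alpha,\beta}$, $A_{\alpha,\beta}$ denote the corresponding infinite matrices. Two infinite matrices $[A_{i,j}]_{i,j\geqslant 0}$ and $[B_{i,j}]_{i,j\geqslant 0}$ are equimodular if $\det[A_{i,j}]_{0\leqslant i,j\leqslant n}=\det[B_{i,j}]_{0\leqslant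 i,j\leqslant n}$ for all $n\geqslant 0$. *)

theory Defs
  imports "HOL-Number_Theory.Fib" "Jordan_Normal_Form.Determinant"
begin

(* Fibonacci numbers extended by F(-1) = 1; below -1 the value is a meaningless 0. *)
definition Fibo :: "int \<Rightarrow> int" where
  "Fibo k = (if k = - 1 then 1 else int (fib (nat k)))"

definition binomial_transform :: "(nat \<Rightarrow> 'a::comm_ring_1) \<Rightarrow> nat \<Rightarrow> 'a" where
  "binomial_transform w i = (\<Sum>k = 0..i. of_nat (i choose k) * w k)"

(* Infinite matrices are functions of the row and the column index. In the three families below,
   a is the first column and b the first row; they are meant for a 0 = b 0. *)
type_synonym 'a infmat = "nat \<Rightarrow> nat \<Rightarrow> 'a"

definition toeplitz :: "(nat \<Rightarrow> 'a) \<Rightarrow> (nat \<Rightarrow> 'a) \<Rightarrow> 'a infmat" where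
  "toeplitz a b i j = (if j \<le> i then a (i - j) else b (j - i))"

fun pascal :: "(nat \<Rightarrow> 'a::comm_ring_1) \<Rightarrow> (nat \<Rightarrow> 'a) \<Rightarrow> 'a infmat" where
  "pascal a b i 0 = a i"
| "pascal a b 0 (Suc j) = b (Suc j)"
| "pascal a b (Suc i) (Suc j) = pascal a b (Suc i) j + pascal a b i (Suc j)"

fun seven_matrix :: "(nat \<Rightarrow> 'a::comm_ring_1) \<Rightarrow> (nat \<Rightarrow> 'a) \<Rightarrow> 'a infmat" where
  "seven_matrix a b i 0 = a i"
| "seven_matrix a b 0 (Suc j) = b (Suc j)"
| "seven_matrix a b (Suc i) (Suc j) = seven_matrix a b i j + seven_matrix a b i (Suc j)"

definition trunc_mat :: "'a infmat \<Rightarrow> nat \<Rightarrow> 'a mat" where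
  "trunc_mat M n = mat (n + 1) (n + 1) (\<lambda>(i, j). M i j)"

definition equimodular :: "'a::comm_ring_1 infmat \<Rightarrow> 'a infmat \<Rightarrow> bool" where
  "equimodular M N \<longleftrightarrow> (\<forall>n. det (trunc_mat M n) = det (trunc_mat N n))"

(* Each family is uniquely determined by its first column, its first row and its rule. *)

lemma toeplitz_iff:
  assumes "a 0 = b 0"
  shows "M = toeplitz a b \<longleftrightarrow>
    (\<forall>i. M i 0 = a i) \<and> (\<forall>j. M 0 j = b j) \<and>
    (\<forall>i j k l. int i - int j = int k - int l \<longrightarrow> M i j = M k l)" (is "_ \<longleftrightarrow> ?R")
proof
  assume M: "M = toeplitz a b"
  have "M i j = M k l" if "int i - int j = int k - int l" for i j k l
  proof -
    have "(j \<le> i) = (l \<le> k)" "i - j = k - l" "j - i = l - k"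
      using that by linarith+
    then show ?thesis
      by (simp add: M toeplitz_def)
  qed
  moreover have "M i 0 = a i" "M 0 j = b j" for i j
    using assms by (simp_all add: M toeplitz_def)
  ultimately show ?R
    by blast
next
  assume ?R
  then have col: "\<And>i. M i 0 = a i" and row: "\<And>j. M 0 j = b j"
    and diag: "\<And>i j k l. int i - int j = int k - int l \<Longrightarrow> M i j = M k l"
    by blast+
  show "M = toeplitz a b"
  proof (intro ext)
    fix i j
    show "M i j = toeplitz a b i j"
    proof (cases "j \<le> i")
      case True
      then have "M i j = M (i - j) 0"
        by (intro diag) (simp add: of_nat_diff)
      then show ?thesis
        using True by (simp add: toeplitz_def col)
    next
      case False
      then have "M i j = M 0 (j - i)"
        by (intro diag) (simp add: of_nat_diff)
      then show ?thesis
        using False by (simp add: toeplitz_def row)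
    qed
  qed
qed

lemma pascal_iff:
  assumes "a 0 = b 0"
  shows "M = pascal a b \<longleftrightarrow>
    (\<forall>i. M i 0 = a i) \<and> (\<forall>j. M 0 j = b j) \<and>
    (\<forall>i\<ge>1. \<forall>j\<ge>1. M i j = M i (j - 1) + M (i - 1) j)" (is "_ \<longleftrightarrow> ?R")
proof
  assume M: "M = pascal a b"
  have "pascal a b 0 j = b j" for j
    using assms by (cases j) auto
  moreover have "pascal a b i j = pascal a b i (j - 1) + pascal a b (i - 1) j"
    if "1 \<le> i" "1 \<le> j" for i j
    using that by (cases i; cases j) auto
  ultimately show ?R
    by (simp add: M)
next
  assume R: ?R
  then have step: "M (Suc i) (Suc j) = M (Suc i) j + M i (Suc j)" for i j
    by (metis diff_Suc_1 le_add1 plus_1_eq_Suc)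
  have "M i j = pascal a b i j" for i j
    using R by (induction a b i j rule: pascal.induct) (simp_all add: step del: One_nat_def)
  then show "M = pascal a b"
    by (intro ext)
qed

lemma seven_matrix_iff:
  assumes "a 0 = b 0"
  shows "M = seven_matrix a b \<longleftrightarrow>
    (\<forall>i. M i 0 = a i) \<and> (\<forall>j. M 0 j = b j) \<and>
    (\<forall>i\<ge>1. \<forall>j\<ge>1. M i j = M (i - 1) (j - 1) + M (i - 1) j)" (is "_ \<longleftrightarrow> ?R")
proof
  assume M: "M = seven_matrix a b"
  have "seven_matrix a b 0 j = b j" for j
    using assms by (cases j) auto
  moreover have "seven_matrix a b i j = seven_matrix a b (i - 1) (j - 1) + seven_matrix a b (i - 1) j"
    if "1 \<le> i" "1 \<le> j" for i j
    using that by (cases i; cases j) auto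
  ultimately show ?R
    by (simp add: M)
next
  assume R: ?R
  then have step: "M (Suc i) (Suc j) = M i j + M i (Suc j)" for i j
    by (metis diff_Suc_1 le_add1 plus_1_eq_Suc)
  have "M i j = seven_matrix a b i j" for i j
    using R by (induction a b i j rule: seven_matrix.induct) (simp_all add: step del: One_nat_def)
  then show "M = seven_matrix a b"
    by (intro ext)
qed

end

theory Submission
  imports Defs
begin

text \<open>
  If \<open>L\<close> is the unipotent lower triangular matrix of binomial coefficients and \<open>T\<close> is the Toeplitz
  matrix with first column \<open>a\<close> and first row \<open>b\<close>, then \<open>L T\<close> is the 7-matrix and \<open>L T L\<^sup>t\<close> is the
  generalized Pascal triangle attached to the binomial transforms, so all determinants agree with
  that of \<open>T\<close>; exchanging \<open>a\<close> and \<open>b\<close> transposes \<open>T\<close>. In the Fibonacci case, subtracting from every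
  column of \<open>T\<close> the two preceding ones turns all columns but the first two into unit vectors, and
  a two by two determinant remains.
\<close>

section \<open>Binomial transforms\<close>

lemma binomial_transform_0 [simp]: "binomial_transform w 0 = w 0"
  by (simp add: binomial_transform_def)

lemma binomial_transform_add:
  "binomial_transform (\<lambda>k. v k + w k) i = binomial_transform v i + binomial_transform w i"
  by (simp add: binomial_transform_def distrib_left sum.distrib)

text \<open>Pascal's rule. With \<open>E\<close> the shift of sequences, the transform at
  \<open>i\<close> is \<open>(1 + E)^i\<close> evaluated at 0, and this peels off one
  factor.\<close>

lemma binomial_transform_Suc:
  "binomial_transform w (Suc i) = binomial_transform w i + binomial_transform (\<lambda>k. w (Suc k)) i"
proof -
  have "binomial_transform w (Suc i)
      = w 0 + (\<Sum>k = 0..i. of_nat (Suc i choose Suc k) * w (Suc k))"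
    unfolding binomial_transform_def by (subst sum.atLeast0_atMost_Suc_shift) simp
  also have "(\<Sum>k = 0..i. of_nat (Suc i choose Suc k) * w (Suc k))
      = binomial_transform (\<lambda>k. w (Suc k)) i
        + (\<Sum>k = 0..i. of_nat (i choose Suc k) * w (Suc k))"
    by (simp add: binomial_transform_def distrib_right sum.distrib)
  also have "w 0 + (binomial_transform (\<lambda>k. w (Suc k)) i
        + (\<Sum>k = 0..i. of_nat (i choose Suc k) * w (Suc k)))
      = binomial_transform (\<lambda>k. w (Suc k)) i + (\<Sum>k = 0..Suc i. of_nat (i choose k) * w k)"
    by (subst sum.atLeast0_atMost_Suc_shift) simp
  also have "(\<Sum>k = 0..Suc i. of_nat (i choose k) * w k) = binomial_transform w i"
    by (simp add: binomial_transform_def binomial_eq_0)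
  finally show ?thesis
    by (simp add: add.commute)
qed

text \<open>Shifting column \<open>Suc j\<close> of a Toeplitz matrix up by one gives column
  \<open>j\<close>, so \<open>binomial_transform_Suc\<close> applied down the columns is exactly the
  7-matrix rule.\<close>

lemma seven_matrix_eq_binomial_transform:
  assumes "a 0 = b 0"
  shows "seven_matrix (binomial_transform a) b
    = (\<lambda>i j. binomial_transform (\<lambda>k. toeplitz a b k j) i)"
proof -
  let ?M = "\<lambda>i j. binomial_transform (\<lambda>k. toeplitz a b k j) i"
  have "?M i 0 = binomial_transform a i" "?M 0 j = b j" for i j
    using assms by (simp_all add: toeplitz_def)
  moreover have "?M (Suc i) (Suc j) = ?M i j + ?M i (Suc j)" for i j
  proof -
    have "toeplitz a b (Suc k) (Suc j) = toeplitz a b k j" for k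
      by (simp only: toeplitz_def Suc_le_mono diff_Suc_Suc)
    then show ?thesis
      by (simp add: binomial_transform_Suc add.commute)
  qed
  ultimately have "?M = seven_matrix (binomial_transform a) b"
    using assms by (subst seven_matrix_iff) (auto simp: Suc_le_eq gr0_conv_Suc)
  then show ?thesis ..
qed

lemma pascal_eq_binomial_transform:
  assumes "a 0 = b 0"
  shows "pascal (binomial_transform a) (binomial_transform b)
    = (\<lambda>i. binomial_transform (seven_matrix (binomial_transform a) b i))"
proof -
  let ?S = "seven_matrix (binomial_transform a) b"
  have "?S 0 = b"
  proof
    show "?S 0 j = b j" for j
      using assms by (cases j) auto
  qed
  \<comment> \<open>By the 7-matrix rule, row \<open>Suc i\<close> shifted by one is row
    \<open>i\<close> plus row \<open>i\<close> shifted; the transform of that sum at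
    \<open>j\<close> is the transform of row \<open>i\<close> at \<open>Suc j\<close>.\<close>
  moreover have "binomial_transform (?S (Suc i)) (Suc j)
      = binomial_transform (?S (Suc i)) j + binomial_transform (?S i) (Suc j)" for i j
    by (simp add: binomial_transform_Suc binomial_transform_add)
  ultimately have "(\<lambda>i. binomial_transform (?S i))
      = pascal (binomial_transform a) (binomial_transform b)"
    using assms by (subst pascal_iff) (auto simp: Suc_le_eq gr0_conv_Suc)
  then show ?thesis ..
qed

section \<open>Determinants of truncations\<close>

lemma det_trunc_mat_transpose:
  "det (trunc_mat (\<lambda>i j. M j i) n) = det (trunc_mat (M :: 'a::comm_ring_1 infmat) n)"
proof -
  have "trunc_mat (\<lambda>i j. M j i) n = (trunc_mat M n)\<^sup>T"
    by (rule eq_matI) (auto simp: trunc_mat_def)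
  then show ?thesis
    using det_transpose[of "trunc_mat M n" "n + 1"] by (simp add: trunc_mat_def)
qed

lemma det_trunc_mat_unitriangular:
  fixes U :: "'a::comm_ring_1 infmat"
  assumes "\<And>i. U i i = 1" "\<And>i j. i < j \<Longrightarrow> U i j = 0"
  shows "det (trunc_mat U n) = 1"
proof -
  have "det (trunc_mat U n) = prod_list (diag_mat (trunc_mat U n))"
    by (rule det_lower_triangular[of "n + 1"]) (auto simp: trunc_mat_def assms)
  also have "diag_mat (trunc_mat U n) = map (\<lambda>_. 1) [0..<n + 1]"
    unfolding diag_mat_def by (rule map_cong) (auto simp: trunc_mat_def assms)
  also have "prod_list (map (\<lambda>_. 1) [0..<n + 1]) = (1 :: 'a)"
    by (simp add: map_replicate_const)
  finally show ?thesis .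
qed

lemma det_trunc_mat_mult:
  fixes A B M :: "'a::comm_ring_1 infmat"
  assumes "\<And>i j. i \<le> n \<Longrightarrow> j \<le> n \<Longrightarrow> M i j = (\<Sum>k\<le>n. A i k * B k j)"
  shows "det (trunc_mat M n) = det (trunc_mat A n) * det (trunc_mat B n)"
proof -
  have "trunc_mat M n = trunc_mat A n * trunc_mat B n"
    by (rule eq_matI)
      (auto simp: trunc_mat_def scalar_prod_def assms atLeastLessThanSuc_atLeastAtMost
        atMost_atLeast0 simp del: sum.op_ivl_Suc)
  moreover have "det (trunc_mat A n * trunc_mat B n) = det (trunc_mat A n) * det (trunc_mat B n)"
    by (rule det_mult[of _ "n + 1"]) (auto simp: trunc_mat_def)
  ultimately show ?thesis
    by simp
qed

text \<open>The transform of the columns is left multiplication by the unitriangular matrix of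
  binomial coefficients. Its triangular shape lets the sum up to \<open>i\<close> be extended to
  \<open>n\<close>, so the product survives truncation.\<close>

lemma det_trunc_mat_binomial_transform:
  fixes M :: "'a::comm_ring_1 infmat"
  shows "det (trunc_mat (\<lambda>i j. binomial_transform (\<lambda>k. M k j) i) n) = det (trunc_mat M n)"
proof -
  have "binomial_transform (\<lambda>k. M k j) i = (\<Sum>k\<le>n. of_nat (i choose k) * M k j)"
    if "i \<le> n" for i j
    unfolding binomial_transform_def using that
    by (intro sum.mono_neutral_left) (auto simp: binomial_eq_0)
  then have "det (trunc_mat (\<lambda>i j. binomial_transform (\<lambda>k. M k j) i) n)
      = det (trunc_mat (\<lambda>i k. of_nat (i choose k)) n) * det (trunc_mat M n)"
    by (rule det_trunc_mat_mult)
  also have "det (trunc_mat (\<lambda>i k. of_nat (i choose k)) n) = (1 :: 'a)"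
    by (rule det_trunc_mat_unitriangular) (auto simp: binomial_eq_0)
  finally show ?thesis
    by simp
qed

lemma det_seven_matrix:
  fixes a b :: "nat \<Rightarrow> 'a::comm_ring_1"
  assumes "a 0 = b 0"
  shows "det (trunc_mat (seven_matrix (binomial_transform a) b) n)
    = det (trunc_mat (toeplitz a b) n)"
  by (simp add: seven_matrix_eq_binomial_transform[of a b, OF assms]
      det_trunc_mat_binomial_transform)

lemma det_pascal:
  fixes a b :: "nat \<Rightarrow> 'a::comm_ring_1"
  assumes "a 0 = b 0"
  shows "det (trunc_mat (pascal (binomial_transform a) (binomial_transform b)) n)
    = det (trunc_mat (toeplitz a b) n)"
proof -
  let ?S = "seven_matrix (binomial_transform a) b"
  \<comment> \<open>The transform acts here along rows; transposing turns it into one down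
    columns.\<close>
  have "det (trunc_mat (pascal (binomial_transform a) (binomial_transform b)) n)
      = det (trunc_mat (\<lambda>i j. binomial_transform (?S j) i) n)"
    by (subst det_trunc_mat_transpose[symmetric])
      (simp add: pascal_eq_binomial_transform[of a b, OF assms])
  also have "\<dots> = det (trunc_mat (\<lambda>i j. ?S j i) n)"
    by (rule det_trunc_mat_binomial_transform)
  also have "\<dots> = det (trunc_mat (toeplitz a b) n)"
    by (simp add: det_trunc_mat_transpose[of ?S] det_seven_matrix[of a b, OF assms])
  finally show ?thesis .
qed

lemma det_toeplitz_swap:
  fixes a b :: "nat \<Rightarrow> 'a::comm_ring_1"
  assumes "a 0 = b 0"
  shows "det (trunc_mat (toeplitz a b) n) = det (trunc_mat (toeplitz b a) n)"
proof -
  have "toeplitz a b = (\<lambda>i j. toeplitz b a j i)"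
    using assms by (auto simp: fun_eq_iff toeplitz_def)
  then show ?thesis
    by (simp add: det_trunc_mat_transpose[of "toeplitz b a"])
qed

text \<open>Laplace expansion along the last column, whose only nonzero entry is a 1 just above the
  bottom row. The minor has the same shape with other \<open>u\<close> and \<open>v\<close>, so
  these vary in the induction.\<close>

lemma det_two_columns_and_units:
  fixes u v :: "nat \<Rightarrow> 'a::comm_ring_1"
  shows "det (trunc_mat (\<lambda>i j. if j = 0 then u i else if j = 1 then v i
      else if j = i + 1 then 1 else 0) (Suc n)) = (- 1) ^ n * (u 0 * v (Suc n) - u (Suc n) * v 0)"
proof (induction n arbitrary: u v)
  case 0
  let ?A = "trunc_mat (\<lambda>i j. if j = 0 then u i else if j = 1 then v i
    else if j = i + 1 then 1 else 0) (Suc 0)"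
  have "det ?A = (\<Sum>i<2. ?A $$ (i, 0) * cofactor ?A i 0)"
    by (rule laplace_expansion_column) (auto simp: trunc_mat_def)
  also have "\<dots> = ?A $$ (0, 0) * cofactor ?A 0 0 + ?A $$ (1, 0) * cofactor ?A 1 0"
    by (simp add: numeral_2_eq_2)
  also have "cofactor ?A 0 0 = ?A $$ (1, 1)"
    unfolding cofactor_def by (subst det_single) (auto simp: mat_delete_def trunc_mat_def)
  also have "cofactor ?A 1 0 = - ?A $$ (0, 1)"
    unfolding cofactor_def by (subst det_single) (auto simp: mat_delete_def trunc_mat_def)
  finally show ?case
    by (simp add: trunc_mat_def)
next
  case (Suc n)
  let ?N = "\<lambda>u v i j. if j = 0 then u i else if j = 1 then v i else if j = i + 1 then 1 else (0 :: 'a)"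
  let ?A = "trunc_mat (?N u v) (Suc (Suc n))"
  \<comment> \<open>Deleting row \<open>n + 1\<close> moves the bottom entry up into its place;
    entries further down lie outside the smaller matrix.\<close>
  let ?skip = "\<lambda>w. w(Suc n := w (Suc (Suc n)) :: 'a)"
  have "det ?A = (\<Sum>i<n + 3. ?A $$ (i, n + 2) * cofactor ?A i (n + 2))"
    by (rule laplace_expansion_column) (auto simp: trunc_mat_def)
  also have "\<dots> = (\<Sum>i\<in>{n + 1}. ?A $$ (i, n + 2) * cofactor ?A i (n + 2))"
    by (rule sum.mono_neutral_right) (auto simp: trunc_mat_def)
  also have "\<dots> = - det (mat_delete ?A (n + 1) (n + 2))"
    by (simp add: trunc_mat_def cofactor_def)
  also have "mat_delete ?A (n + 1) (n + 2) = trunc_mat (?N (?skip u) (?skip v)) (Suc n)"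
    by (rule eq_matI) (auto simp: trunc_mat_def mat_delete_def less_Suc_eq)
  also have "- det \<dots> = (- 1) ^ Suc n * (u 0 * v (Suc (Suc n)) - u (Suc (Suc n)) * v 0)"
    by (subst Suc.IH) simp
  finally show ?case .
qed

section \<open>Fibonacci numbers of integer index\<close>

text \<open>The two-sided Fibonacci sequence, satisfying the recurrence at every integer, whereas
  \<open>Fibo\<close> is cut off below -1.\<close>

definition fib_int :: "int \<Rightarrow> int" where
  "fib_int k = (if 0 \<le> k then int (fib (nat k)) else (- 1) ^ (nat (- k) + 1) * int (fib (nat (- k))))"

lemma fib_int_of_nat: "fib_int (int k) = int (fib k)"
  by (simp add: fib_int_def)

lemma fib_int_uminus_of_nat: "fib_int (- int k) = (- 1) ^ (k + 1) * int (fib k)"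
  by (cases "k = 0") (simp_all add: fib_int_def)

lemma fib_int_rec: "fib_int (k + 2) = fib_int (k + 1) + fib_int k"
proof (cases "0 \<le> k")
  case True
  then obtain m where "k = int m"
    by (rule nonneg_int_cases)
  then show ?thesis
    using fib_int_of_nat[of "m + 2"] fib_int_of_nat[of "m + 1"] fib_int_of_nat[of m]
    by (simp add: algebra_simps)
next
  case False
  show ?thesis
  proof (cases "k = - 1")
    \<comment> \<open>The only negative \<open>k\<close> for which \<open>k + 2\<close> is positive;
      below it all three indices are nonpositive and the sign formula covers them.\<close>
    case True
    then show ?thesis
      by (simp add: fib_int_def)
  next
    case False
    define m where "m = nat (- k - 2)"
    have k: "k = - int (m + 2)"
      using False \<open>\<not> 0 \<le> k\<close> by (simp add: m_def)
    then have "fib_int (k + 2) = fib_int (- int m)" "fib_int (k + 1) = fib_int (- int (m + 1))"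
      "fib_int k = fib_int (- int (m + 2))"
      by (auto intro!: arg_cong[where f = fib_int])
    then show ?thesis
      unfolding fib_int_uminus_of_nat by (simp add: distrib_left)
  qed
qed

lemma Fibo_eq_fib_int: "- 1 \<le> k \<Longrightarrow> Fibo k = fib_int k"
  by (cases "k = - 1") (auto simp: Fibo_def fib_int_def)

text \<open>The alternating signs amount to negative indices, so the first column and the first row
  both come from one two-sided sequence.\<close>

lemma alternating_Fibo: "(- 1) ^ k * Fibo (int k + 1) = fib_int (- 1 - int k)"
  using fib_int_uminus_of_nat[of "k + 1"] fib_int_of_nat[of "k + 1"]
  by (simp add: Fibo_eq_fib_int add.commute)

text \<open>On Fibonacci sequences \<open>1 + E = E^2\<close>, so each step of the transform
  advances the index by two.\<close>

lemma binomial_transform_fib_int: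
  "binomial_transform (\<lambda>k. fib_int (m + int k)) i = fib_int (m + 2 * int i)"
proof (induction i arbitrary: m)
  case 0
  show ?case by simp
next
  case (Suc i)
  show ?case
    using Suc.IH[of m] Suc.IH[of "m + 1"] fib_int_rec[of "m + 2 * int i"]
    by (simp add: binomial_transform_Suc algebra_simps)
qed

text \<open>Reading backwards replaces \<open>E\<close> by its inverse, and
  \<open>1 + E^(-1) = E\<close>: each step advances the index by one.\<close>

lemma binomial_transform_fib_int_descending:
  "binomial_transform (\<lambda>k. fib_int (m - int k)) i = fib_int (m + int i)"
proof (induction i arbitrary: m)
  case 0
  show ?case by simp
next
  case (Suc i)
  show ?case
    using Suc.IH[of m] Suc.IH[of "m - 1"] fib_int_rec[of "m + int i - 1"]
    by (simp add: binomial_transform_Suc algebra_simps)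
qed

section \<open>The Fibonacci Toeplitz determinant\<close>

lemma det_toeplitz_fib:
  "det (trunc_mat (toeplitz (\<lambda>i. fib_int (- 1 - int i)) (\<lambda>i. fib_int (1 + int i))) n)
    = fib_int (int n + 2)"
    (is "det (trunc_mat ?T n) = _")
proof (cases n)
  case 0
  then show ?thesis
    by (subst det_single) (auto simp: trunc_mat_def toeplitz_def fib_int_def numeral_eq_Suc)
next
  case (Suc m)
  \<comment> \<open>Right multiplication by the unitriangular \<open>?C\<close> subtracts from each
    column the two before it; column 1 has just one predecessor, whence \<open>?v\<close>.\<close>
  let ?C = "\<lambda>k j. if k = j then 1 else if k + 1 = j \<or> k + 2 = j then - 1 else (0 :: int)"
  let ?u = "\<lambda>i. fib_int (- 1 - int i)"
  let ?v = "\<lambda>i. ?T i 1 - ?T i 0"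
  let ?N = "\<lambda>i j. if j = 0 then ?u i else if j = 1 then ?v i else if j = i + 1 then 1 else 0"
  have *: "?N i j = (\<Sum>k\<le>n. ?T i k * ?C k j)" if "j \<le> n" for i j
  proof -
    consider "j = 0" | "j = 1" | l where "j = l + 2"
      by (metis One_nat_def add_2_eq_Suc' not0_implies_Suc)
    then show ?thesis
    proof cases
      case 1
      have "(\<Sum>k\<le>n. ?T i k * ?C k j) = (\<Sum>k\<in>{0}. ?T i k * ?C k j)"
        using 1 by (intro sum.mono_neutral_right) auto
      then show ?thesis
        using 1 by (simp add: toeplitz_def)
    next
      case 2
      have "(\<Sum>k\<le>n. ?T i k * ?C k j) = (\<Sum>k\<in>{0, 1}. ?T i k * ?C k j)"
        using 2 that by (intro sum.mono_neutral_right) auto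
      then show ?thesis
        using 2 by simp
    next
      case 3
      have "(\<Sum>k\<le>n. ?T i k * ?C k j) = (\<Sum>k\<in>{l, l + 1, l + 2}. ?T i k * ?C k j)"
        using 3 that by (intro sum.mono_neutral_right) auto
      also have "\<dots> = ?T i (l + 2) - ?T i (l + 1) - ?T i l"
        using 3 by simp
      \<comment> \<open>Row and column both obey the Fibonacci recurrence and share the value \<open>F\<^sub>1 = F\<^sub>-\<^sub>1\<close> on the
        diagonal, so the recurrence fails only on the first superdiagonal.\<close>
      also have "\<dots> = (if l + 1 = i then 1 else 0)"
      proof (rule linorder_cases[of "l + 1" i])
        assume "l + 1 < i"
        then have "int (i - (l + 2)) = int i - int l - 2" "int (i - (l + 1)) = int i - int l - 1"
          "int (i - l) = int i - int l"
          by linarith+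
        then show ?thesis
          using \<open>l + 1 < i\<close> fib_int_rec[of "int l - int i - 1"]
          by (simp add: toeplitz_def algebra_simps)
      next
        assume "l + 1 = i"
        then show ?thesis
          by (auto simp: toeplitz_def fib_int_def numeral_eq_Suc)
      next
        assume "i < l + 1"
        then have "int (l + 2 - i) = int l - int i + 2" "int (l + 1 - i) = int l - int i + 1"
          "int (l - i) = int l - int i"
          by linarith+
        \<comment> \<open>For \<open>l = i\<close> the entry comes from the first column as F(-1),
          which must be read as F(1) for the row recurrence to apply.\<close>
        moreover have "?T i l = fib_int (1 + int (l - i))"
          using \<open>i < l + 1\<close> by (cases "l = i") (auto simp: toeplitz_def fib_int_def)
        ultimately show ?thesis
          using \<open>i < l + 1\<close> fib_int_rec[of "int l - int i + 1"]
          by (simp add: toeplitz_def algebra_simps)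
      qed
      finally show ?thesis
        using 3 by auto
    qed
  qed
  have "det (trunc_mat ?C n) = 1"
    by (subst det_trunc_mat_transpose[symmetric], rule det_trunc_mat_unitriangular) auto
  then have "det (trunc_mat ?T n) = det (trunc_mat ?N n)"
    using det_trunc_mat_mult[of n ?N ?T ?C, OF *] by simp
  also have "\<dots> = (- 1) ^ m * (?u 0 * ?v n - ?u n * ?v 0)"
    unfolding Suc by (rule det_two_columns_and_units)
  also have "\<dots> = fib_int (int n + 2)"
  proof -
    have "?u 0 = 1" "?v 0 = 0"
      by (simp_all add: toeplitz_def fib_int_def)
    \<comment> \<open>The entry is F(-n) - F(-n-1) = F(-n-2); its sign cancels the factor
      \<open>(- 1) ^ m\<close> of the determinant.\<close>
    moreover have "?v n = (- 1) ^ m * fib_int (int n + 2)"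
      using fib_int_rec[of "- int (m + 3)"] fib_int_uminus_of_nat[of "m + 3"]
        fib_int_of_nat[of "n + 2"]
      by (simp add: Suc toeplitz_def algebra_simps numeral_eq_Suc)
    ultimately show ?thesis
      by (simp flip: power_mult_distrib mult.assoc)
  qed
  finally show ?thesis .
qed

theorem corollary4:
  fixes \<alpha> \<alpha>' \<gamma> \<gamma>' :: "nat \<Rightarrow> int"
  assumes "\<alpha> = (\<lambda>i. Fibo (int i + 1))"
    and "\<alpha>' = (\<lambda>i. (-1) ^ i * Fibo (int i + 1))"
    and "\<gamma> = binomial_transform \<alpha>"
    and "\<gamma>' = binomial_transform \<alpha>'"
  shows "\<gamma> = (\<lambda>i. Fibo (2 * int i + 1)) \<and>
    \<gamma>' = (\<lambda>i. Fibo (int i - 1)) \<and>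
    (\<forall>M \<in> {toeplitz \<alpha>' \<alpha>, toeplitz \<alpha> \<alpha>', pascal \<gamma>' \<gamma>, pascal \<gamma> \<gamma>',
           seven_matrix \<gamma>' \<alpha>, seven_matrix \<gamma> \<alpha>'}.
     \<forall>N \<in> {toeplitz \<alpha>' \<alpha>, toeplitz \<alpha> \<alpha>', pascal \<gamma>' \<gamma>, pascal \<gamma> \<gamma>',
           seven_matrix \<gamma>' \<alpha>, seven_matrix \<gamma> \<alpha>'}. equimodular M N) \<and>
    (\<forall>n::nat.
      det (trunc_mat (toeplitz \<alpha>' \<alpha>) n) = Fibo (int n + 2) \<and>
      det (trunc_mat (toeplitz \<alpha> \<alpha>') n) = Fibo (int n + 2) \<and>
      det (trunc_mat (pascal \<gamma>' \<gamma>) n) = Fibo (int n + 2) \<and>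
      det (trunc_mat (pascal \<gamma> \<gamma>') n) = Fibo (int n + 2) \<and>
      det (trunc_mat (seven_matrix \<gamma>' \<alpha>) n) = Fibo (int n + 2) \<and>
      det (trunc_mat (seven_matrix \<gamma> \<alpha>') n) = Fibo (int n + 2))"
proof -
  have \<alpha>: "\<alpha> = (\<lambda>i. fib_int (1 + int i))"
    by (simp add: assms(1) Fibo_eq_fib_int add.commute)
  have \<alpha>': "\<alpha>' = (\<lambda>i. fib_int (- 1 - int i))"
    by (simp add: assms(2) alternating_Fibo)
  have "\<alpha>' 0 = \<alpha> 0"
    by (simp add: \<alpha> \<alpha>' fib_int_def)
  note eq0 = this this[symmetric]
  have \<gamma>: "\<gamma> = (\<lambda>i. Fibo (2 * int i + 1))"
    unfolding assms(3) \<alpha>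
    by (simp add: fun_eq_iff binomial_transform_fib_int Fibo_eq_fib_int add.commute)
  have \<gamma>': "\<gamma>' = (\<lambda>i. Fibo (int i - 1))"
    unfolding assms(4) \<alpha>'
    by (simp add: fun_eq_iff binomial_transform_fib_int_descending Fibo_eq_fib_int)
  have T: "det (trunc_mat (toeplitz \<alpha>' \<alpha>) n) = Fibo (int n + 2)" for n
    unfolding \<alpha> \<alpha>' det_toeplitz_fib by (simp add: Fibo_eq_fib_int)
  have T': "det (trunc_mat (toeplitz \<alpha> \<alpha>') n) = Fibo (int n + 2)" for n
    using T det_toeplitz_swap[of \<alpha> \<alpha>' n, OF eq0(2)] by simp
  \<comment> \<open>Each of the two comparison lemmas is used with the sequences in both
    orders.\<close>
  have dets:
    "det (trunc_mat (pascal \<gamma>' \<gamma>) n) = Fibo (int n + 2)"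
    "det (trunc_mat (pascal \<gamma> \<gamma>') n) = Fibo (int n + 2)"
    "det (trunc_mat (seven_matrix \<gamma>' \<alpha>) n) = Fibo (int n + 2)"
    "det (trunc_mat (seven_matrix \<gamma> \<alpha>') n) = Fibo (int n + 2)" for n
    unfolding assms(3,4)
    by (simp_all add: det_pascal[of \<alpha> \<alpha>', OF eq0(2)] det_pascal[of \<alpha>' \<alpha>, OF eq0(1)]
        det_seven_matrix[of \<alpha> \<alpha>', OF eq0(2)] det_seven_matrix[of \<alpha>' \<alpha>, OF eq0(1)] T T')
  show ?thesis
    using \<gamma> \<gamma>' T T' dets by (auto simp: equimodular_def)
qed

end
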